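(* Let $\alpha>0$, let $\mathcal{X}$ be a finite state space with passive dynamics $\pi_0$, let $T\ge 1$, and let $q(x,t)$ be a real state cost. Consider the two-player zero-sum Markov game described in the context, in which the controller's transition density is $u_c$, the adversary's is $u_a$, the next state is distributed according to $u_a$, and the stage cost is $$c(x,u_c,u_a,t)=q(x,t)+\mathbb{D}_\alpha(\pi_0(\cdot|x)\|u_c)-\tfrac1\alpha\mathrm{KL}(u_a\|u_c).$$ Let $v^{(\alpha)}_t$ be its upper value function, i.e. the solution of the Bellman–Isaacs equation $$v^{(\alpha)}_t(x)=\min_{u_c\in\mathcal{U}_c(x)}\max_{u_a}\left\{c(x,u_c,u_a,t)+\mathrm{E}_{u_a}\left[v^{(\alpha)}_{t+1}\right]\right\},\quad 0\le t\le T-1,\qquad v^{(\alpha)}_T(x)=q(x,T).$$ Then $v^{(\alpha)}$ satisfies the Bellman equation of the $\alpha$-RLC, $$v^{(\alpha)}_t(x)=q(x,t)+\min_{u_c\in\mathcal{U}_c(x)}\left\{\mathbb{D}_\alpha(\pi_0(\cdot|x)\|u_c)+\Psi^\alpha_{u_c}\left[v^{(\alpha)}_{t+1}\right]\right\},$$ and the controller's optimal strategy $\pi^*_{co}$ in the game coincides with the optimal control law of the $\alpha$-RLC. The adversary's optimal strategy (the best response to $\pi^*_{co}$) is $$\pi_a^*(x'|x,t)\propto\pi_{co}^*(x'|x,t)\exp\left(\alpha v^{(\alpha)}_{t+1}(x')\right)\propto\pi_0(x'|x)\exp\left((\alpha-1)v^{(\alpha)}_{t+1}(x')\right),$$ where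 $\propto$ denotes equality up to normalization over $x'\in\mathcal{X}$.
   Context: $\mathcal{X}$ is a finite set and $\mathcal{P}[\mathcal{X}]$ is the set of probability distributions on $\mathcal{X}$; $\mathrm{supp}[p]=\{x:p(x)>0\}$. The passive dynamics is a map $x\mapsto\pi_0(\cdot|x)\in\mathcal{P}[\mathcal{X}]$. For $p\in\mathcal{P}[\mathcal{X}]$ and $f:\mathcal{X}\to\mathbb{R}$: $\mathrm{E}_p[f]=\sum_x p(x)f(x)$ and $\Psi^\alpha_p[f]=\alpha^{-1}\log\left(\mathrm{E}_p[\exp(\alpha f)]\right)$ for $\alpha\neq0$. $\mathrm{KL}(p\|q)=\sum_x p(x)\log\frac{p(x)}{q(x)}$, defined when $\mathrm{supp}[p]\subseteq\mathrm{supp}[q]$. Rényi divergence of order $\alpha>0$ (with this paper's normalization): for $\alpha\ne1$, $\mathbb{D}_\alpha(p\|q)=\frac{1}{\alpha(\alpha-1)}\log\left(\sum_{x}p(x)^\alpha q(x)^{1-\alpha}\right)$, the sum being over $x\in\mathrm{supp}[p]\cap\mathrm{supp}[q]$; $\mathbb{D}_1(p\|q)=\mathrm{KL}(p\|q)$. It is defined when $\mathrm{supp}[p]\cap\mathrm{supp}[q]\neq\emptyset$ if $\alpha\in(0,1)$ and when $\mathrm{supp}[p]\subseteq\mathrm{supp}[q]$ if $\alpha\ge1$. $\mathcal{U}_c(x)$ is the set of $u\in\mathcal{P}[\mathcal{X}]$ for which $\mathbb{D}_\alpha(\pi_0(\cdot|x)\|u)$ is defined. The game: in state $x$ at time $t$,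 player 1 (controller, minimizing) picks $u_c\in\mathcal{U}_c(x)$; then player 2 (adversary, maximizing), knowing $u_c$, picks $u_a\in\mathcal{P}[\mathcal{X}]$ with $\mathrm{supp}[u_a]\subseteq\mathrm{supp}[u_c]$; the system moves to $x'\sim u_a$. The optimal strategy of the controller is the $u_c$ attaining the outer minimum, and the optimal strategy of the adversary is the $u_a$ attaining the inner maximum at that $u_c$. The $\alpha$-RLC is the risk-sensitive control problem with state cost $q(x,t)$, control cost $\mathbb{D}_\alpha(\pi_0(\cdot|x)\|u_c)$, next state $x'\sim u_c$, whose optimal control law is the control attaining the minimum in its Bellman equation. *)

theory Defs
  imports "HOL-Probability.Probability"
begin

text \<open>The finite set of states is a type \<open>'x :: finite\<close>; the distributions on it are \<open>'x pmf\<close>,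
  with support \<^const>\<open>set_pmf\<close>.\<close>

text \<open>The value of \<open>min_over f S\<close> (\<open>max_over f S\<close>) is meaningful only if \<open>f\<close> attains a minimum
  (maximum) on \<open>S\<close>.\<close>

definition min_over :: "('b \<Rightarrow> real) \<Rightarrow> 'b set \<Rightarrow> real" where
  "min_over f S = (LEAST y. y \<in> f ` S)"

definition max_over :: "('b \<Rightarrow> real) \<Rightarrow> 'b set \<Rightarrow> real" where
  "max_over f S = (GREATEST y. y \<in> f ` S)"

definition proportional :: "('x \<Rightarrow> real) \<Rightarrow> ('x \<Rightarrow> real) \<Rightarrow> bool" where
  "proportional f g \<longleftrightarrow> (\<exists>c>0. \<forall>x. f x = c * g x)"

text \<open>Terms with \<open>pmf p x = 0\<close> vanish, so the sum is the usual one whenever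
  \<open>set_pmf p \<subseteq> set_pmf r\<close>.\<close>

definition KL :: "'x::finite pmf \<Rightarrow> 'x pmf \<Rightarrow> real" where
  "KL p r = (\<Sum>x\<in>UNIV. pmf p x * ln (pmf p x / pmf r x))"

definition renyi_defined :: "real \<Rightarrow> 'x::finite pmf \<Rightarrow> 'x pmf \<Rightarrow> bool" where
  "renyi_defined \<alpha> p r \<longleftrightarrow>
     (if \<alpha> < 1 then set_pmf p \<inter> set_pmf r \<noteq> {} else set_pmf p \<subseteq> set_pmf r)"

definition renyi :: "real \<Rightarrow> 'x::finite pmf \<Rightarrow> 'x pmf \<Rightarrow> real" where
  "renyi \<alpha> p r =
     (if \<alpha> = 1 then KL p r
      else 1 / (\<alpha> * (\<alpha> - 1)) *
        ln (\<Sum>x \<in> set_pmf p \<inter> set_pmf r. pmf p x powr \<alpha> * pmf r x powr (1 - \<alpha>)))"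

definition Psi :: "real \<Rightarrow> 'x::finite pmf \<Rightarrow> ('x \<Rightarrow> real) \<Rightarrow> real" where
  "Psi \<alpha> p f = 1 / \<alpha> * ln (measure_pmf.expectation p (\<lambda>x. exp (\<alpha> * f x)))"

definition controls :: "real \<Rightarrow> ('x::finite \<Rightarrow> 'x pmf) \<Rightarrow> 'x \<Rightarrow> 'x pmf set" where
  "controls \<alpha> \<pi>0 x = {u. renyi_defined \<alpha> (\<pi>0 x) u}"

definition adversary_controls :: "'x::finite pmf \<Rightarrow> 'x pmf set" where
  "adversary_controls uc = {ua. set_pmf ua \<subseteq> set_pmf uc}"

definition stage_cost ::
  "real \<Rightarrow> ('x::finite \<Rightarrow> 'x pmf) \<Rightarrow> ('x \<Rightarrow> nat \<Rightarrow> real) \<Rightarrow> 'x \<Rightarrow> 'x pmf \<Rightarrow> 'x pmf \<Rightarrow> nat \<Rightarrow> real" where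
  "stage_cost \<alpha> \<pi>0 q x uc ua t = q x t + renyi \<alpha> (\<pi>0 x) uc - 1 / \<alpha> * KL ua uc"

text \<open>In the following, \<open>v t x\<close> is the value of state \<open>x\<close> at time \<open>t\<close>.\<close>

definition game_objective ::
  "real \<Rightarrow> ('x::finite \<Rightarrow> 'x pmf) \<Rightarrow> ('x \<Rightarrow> nat \<Rightarrow> real) \<Rightarrow> (nat \<Rightarrow> 'x \<Rightarrow> real) \<Rightarrow>
     nat \<Rightarrow> 'x \<Rightarrow> 'x pmf \<Rightarrow> 'x pmf \<Rightarrow> real" where
  "game_objective \<alpha> \<pi>0 q v t x uc ua =
     stage_cost \<alpha> \<pi>0 q x uc ua t + measure_pmf.expectation ua (v (Suc t))"

definition worst_case ::
  "real \<Rightarrow> ('x::finite \<Rightarrow> 'x pmf) \<Rightarrow> ('x \<Rightarrow> nat \<Rightarrow> real) \<Rightarrow> (nat \<Rightarrow> 'x \<Rightarrow> real) \<Rightarrow>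
     nat \<Rightarrow> 'x \<Rightarrow> 'x pmf \<Rightarrow> real" where
  "worst_case \<alpha> \<pi>0 q v t x uc =
     max_over (game_objective \<alpha> \<pi>0 q v t x uc) (adversary_controls uc)"

definition bellman_isaacs ::
  "real \<Rightarrow> ('x::finite \<Rightarrow> 'x pmf) \<Rightarrow> ('x \<Rightarrow> nat \<Rightarrow> real) \<Rightarrow> nat \<Rightarrow> (nat \<Rightarrow> 'x \<Rightarrow> real) \<Rightarrow> bool" where
  "bellman_isaacs \<alpha> \<pi>0 q T v \<longleftrightarrow>
     (\<forall>t<T. \<forall>x. v t x = min_over (worst_case \<alpha> \<pi>0 q v t x) (controls \<alpha> \<pi>0 x)) \<and>
     (\<forall>x. v T x = q x T)"

text \<open>Strategies are given by \<open>\<pi> t x\<close>, the transition distribution chosen in state \<open>x\<close> at time \<open>t\<close>;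
  only times \<open>t < T\<close> matter.\<close>

definition controller_optimal ::
  "real \<Rightarrow> ('x::finite \<Rightarrow> 'x pmf) \<Rightarrow> ('x \<Rightarrow> nat \<Rightarrow> real) \<Rightarrow> nat \<Rightarrow> (nat \<Rightarrow> 'x \<Rightarrow> real) \<Rightarrow>
     (nat \<Rightarrow> 'x \<Rightarrow> 'x pmf) \<Rightarrow> bool" where
  "controller_optimal \<alpha> \<pi>0 q T v \<pi> \<longleftrightarrow>
     (\<forall>t<T. \<forall>x. is_arg_min (worst_case \<alpha> \<pi>0 q v t x) (\<lambda>uc. uc \<in> controls \<alpha> \<pi>0 x) (\<pi> t x))"

definition adversary_best_response ::
  "real \<Rightarrow> ('x::finite \<Rightarrow> 'x pmf) \<Rightarrow> ('x \<Rightarrow> nat \<Rightarrow> real) \<Rightarrow> nat \<Rightarrow> (nat \<Rightarrow> 'x \<Rightarrow> real) \<Rightarrow>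
     (nat \<Rightarrow> 'x \<Rightarrow> 'x pmf) \<Rightarrow> (nat \<Rightarrow> 'x \<Rightarrow> 'x pmf) \<Rightarrow> bool" where
  "adversary_best_response \<alpha> \<pi>0 q T v \<pi> \<rho> \<longleftrightarrow>
     (\<forall>t<T. \<forall>x. is_arg_max (game_objective \<alpha> \<pi>0 q v t x (\<pi> t x))
        (\<lambda>ua. ua \<in> adversary_controls (\<pi> t x)) (\<rho> t x))"

definition rlc_objective ::
  "real \<Rightarrow> ('x::finite \<Rightarrow> 'x pmf) \<Rightarrow> (nat \<Rightarrow> 'x \<Rightarrow> real) \<Rightarrow> nat \<Rightarrow> 'x \<Rightarrow> 'x pmf \<Rightarrow> real" where
  "rlc_objective \<alpha> \<pi>0 v t x uc = renyi \<alpha> (\<pi>0 x) uc + Psi \<alpha> uc (v (Suc t))"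

definition rlc_bellman ::
  "real \<Rightarrow> ('x::finite \<Rightarrow> 'x pmf) \<Rightarrow> ('x \<Rightarrow> nat \<Rightarrow> real) \<Rightarrow> nat \<Rightarrow> (nat \<Rightarrow> 'x \<Rightarrow> real) \<Rightarrow> bool" where
  "rlc_bellman \<alpha> \<pi>0 q T v \<longleftrightarrow>
     (\<forall>t<T. \<forall>x. v t x = q x t + min_over (rlc_objective \<alpha> \<pi>0 v t x) (controls \<alpha> \<pi>0 x)) \<and>
     (\<forall>x. v T x = q x T)"

text \<open>Optimality in the control problem refers to that problem's own Bellman equation, not to the
  value function of the game.\<close>

definition rlc_optimal ::
  "real \<Rightarrow> ('x::finite \<Rightarrow> 'x pmf) \<Rightarrow> ('x \<Rightarrow> nat \<Rightarrow> real) \<Rightarrow> nat \<Rightarrow> (nat \<Rightarrow> 'x \<Rightarrow> 'x pmf) \<Rightarrow> bool" where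
  "rlc_optimal \<alpha> \<pi>0 q T \<pi> \<longleftrightarrow>
     (\<exists>w. rlc_bellman \<alpha> \<pi>0 q T w \<and>
       (\<forall>t<T. \<forall>x. is_arg_min (rlc_objective \<alpha> \<pi>0 w t x) (\<lambda>uc. uc \<in> controls \<alpha> \<pi>0 x) (\<pi> t x)))"

end

theory Submission
  imports Defs
begin

text \<open>Write \<open>tilt p f\<close> for the distribution proportional to \<open>p exp f\<close>.  Gibbs' variational principle
  makes \<open>tilt u\<^sub>c (\<alpha> f)\<close> the unique best response to \<open>u\<^sub>c\<close> and turns the inner maximum into the
  risk-sensitive term \<open>\<Psi>\<close>.  Tilting both arguments of the Renyi divergence absorbs \<open>\<Psi>\<close>: up to a
  constant independent of \<open>u\<^sub>c\<close>, the outer objective is the divergence of \<open>tilt u\<^sub>c (\<alpha> f)\<close> from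
  \<open>tilt \<pi>\<^sub>0 ((\<alpha> - 1) f)\<close>, which vanishes exactly for \<open>u\<^sub>c = tilt \<pi>\<^sub>0 (- f)\<close> and is positive
  otherwise.\<close>

section \<open>Attained extrema\<close>

text \<open>Strictness gives attainment and uniqueness together, so each optimization problem below
  reduces to one strict inequality at a candidate.\<close>

lemma is_arg_min_iff_unique:
  fixes F :: "'b \<Rightarrow> real"
  assumes "a \<in> S" and "\<And>u. u \<in> S \<Longrightarrow> u \<noteq> a \<Longrightarrow> F a < F u"
  shows "is_arg_min F (\<lambda>u. u \<in> S) x \<longleftrightarrow> x = a"
  unfolding is_arg_min_def using assms by (metis less_irrefl less_asym)

lemma is_arg_max_iff_unique:
  fixes F :: "'b \<Rightarrow> real"
  assumes "a \<in> S" and "\<And>u. u \<in> S \<Longrightarrow> u \<noteq> a \<Longrightarrow> F u < F a"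
  shows "is_arg_max F (\<lambda>u. u \<in> S) x \<longleftrightarrow> x = a"
  unfolding is_arg_max_def using assms by (metis less_irrefl less_asym)

lemma min_over_eqI:
  assumes "a \<in> S" and "\<And>u. u \<in> S \<Longrightarrow> F a \<le> F u"
  shows "min_over F S = F a"
  unfolding min_over_def using assms by (intro Least_equality) auto

lemma max_over_eqI:
  assumes "a \<in> S" and "\<And>u. u \<in> S \<Longrightarrow> F u \<le> F a"
  shows "max_over F S = F a"
  unfolding max_over_def using assms by (intro Greatest_equality) auto

section \<open>Exponential tilting\<close>

lemma expectation_pmf_finite:
  fixes p :: "'x::finite pmf" and f :: "'x \<Rightarrow> real"
  shows "measure_pmf.expectation p f = (\<Sum>x\<in>UNIV. pmf p x * f x)"
  by (subst integral_measure_pmf[of UNIV]) auto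

lemma sum_pmf_UNIV: "(\<Sum>x\<in>UNIV. pmf (p :: 'x::finite pmf) x) = 1"
  using sum_pmf_eq_1[of UNIV p] by simp

definition partition_sum :: "'x::finite pmf \<Rightarrow> ('x \<Rightarrow> real) \<Rightarrow> real" where
  "partition_sum p f = (\<Sum>x\<in>UNIV. pmf p x * exp (f x))"

text \<open>Exponential tilting, also known as the Esscher transform. \<open>embed_pmf\<close> is
  meaningful here because the weights are nonnegative and sum to one, which the proof of
  \<open>pmf_tilt\<close> establishes.\<close>

definition tilt :: "'x::finite pmf \<Rightarrow> ('x \<Rightarrow> real) \<Rightarrow> 'x pmf" where
  "tilt p f = embed_pmf (\<lambda>x. pmf p x * exp (f x) / partition_sum p f)"

lemma partition_sum_pos: "partition_sum p f > 0"
proof -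
  obtain x where "x \<in> set_pmf p"
    using set_pmf_not_empty by fast
  then have "pmf p x * exp (f x) > 0"
    by (simp add: pmf_positive)
  then show ?thesis
    unfolding partition_sum_def by (intro sum_pos2[of _ x]) auto
qed

lemma pmf_tilt: "pmf (tilt p f) x = pmf p x * exp (f x) / partition_sum p f"
proof -
  have nonneg: "0 \<le> pmf p y * exp (f y) / partition_sum p f" for y
    using partition_sum_pos[of p f] by simp
  have "(\<Sum>y\<in>UNIV. pmf p y * exp (f y) / partition_sum p f) = 1"
    using partition_sum_pos[of p f]
    by (simp add: sum_divide_distrib[symmetric] partition_sum_def[symmetric])
  then have "(\<integral>\<^sup>+ y. ennreal (pmf p y * exp (f y) / partition_sum p f) \<partial>count_space UNIV) = 1"
    using nonneg by (simp add: nn_integral_count_space_finite sum_ennreal)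
  then show ?thesis
    unfolding tilt_def by (intro pmf_embed_pmf nonneg)
qed

lemma set_pmf_tilt [simp]: "set_pmf (tilt p f) = set_pmf p"
  using partition_sum_pos[of p f] by (auto simp: set_pmf_iff pmf_tilt)

text \<open>Total mass one forces the value of \<open>c\<close>, so proportionality to the weights
  already determines the distribution.\<close>

lemma tilt_eqI:
  assumes "\<And>x. pmf r x = c * (pmf p x * exp (f x))"
  shows "r = tilt p f"
proof -
  have "1 = (\<Sum>x\<in>UNIV. pmf r x)"
    by (simp add: sum_pmf_UNIV)
  also have "\<dots> = c * partition_sum p f"
    by (simp add: assms partition_sum_def sum_distrib_left)
  finally have "c = 1 / partition_sum p f"
    using partition_sum_pos[of p f] by (simp add: field_simps)
  then show ?thesis
    by (intro pmf_eqI) (simp add: assms pmf_tilt)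
qed

lemma tilt_tilt: "tilt (tilt p f) g = tilt p (\<lambda>x. f x + g x)"
  by (rule tilt_eqI[where c = "1 / (partition_sum p f * partition_sum (tilt p f) g)"])
    (simp add: pmf_tilt exp_add)

lemma tilt_zero: "tilt p (\<lambda>_. 0) = p"
  by (rule tilt_eqI[where c = 1, symmetric]) simp

text \<open>Tilting by \<open>- f\<close> undoes tilting by \<open>f\<close>. Injectivity later
  carries uniqueness from the tilted control back to the control itself.\<close>

lemma tilt_inject [simp]: "tilt p f = tilt r f \<longleftrightarrow> p = r"
proof
  assume "tilt p f = tilt r f"
  then have "tilt (tilt p f) (\<lambda>x. - f x) = tilt (tilt r f) (\<lambda>x. - f x)"
    by simp
  then show "p = r"
    by (simp add: tilt_tilt tilt_zero)
qed simp

lemma proportional_tilt: "proportional (pmf (tilt p f)) (\<lambda>x. pmf p x * exp (f x))"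
  unfolding proportional_def
  using partition_sum_pos[of p f] by (intro exI[of _ "1 / partition_sum p f"]) (auto simp: pmf_tilt)

lemma Psi_eq_ln_partition_sum: "Psi \<alpha> p f = 1 / \<alpha> * ln (partition_sum p (\<lambda>x. \<alpha> * f x))"
  by (simp add: Psi_def expectation_pmf_finite partition_sum_def)

section \<open>Strict positivity of the divergences\<close>

text \<open>This is the strict bound \<open>ln z < z - 1\<close> for \<open>z \<noteq> 1\<close>,
  taken at \<open>z = b / a\<close> and multiplied by \<open>a\<close>.\<close>

lemma mult_ln_div_gt:
  fixes a b :: real
  assumes "0 \<le> a" "0 \<le> b" "b = 0 \<longrightarrow> a = 0" "a \<noteq> b"
  shows "a - b < a * ln (a / b)"
proof (cases "a = 0")
  case False
  then have pos: "0 < a" "0 < b"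
    using assms by auto
  have "ln (b / a) < b / a - 1"
    using pos assms(4) ln_le_minus_one[of "b / a"] ln_eq_minus_one[of "b / a"] by fastforce
  then have "a * ln (b / a) < b - a"
    using pos by (simp add: field_simps)
  then show ?thesis
    using pos by (simp add: ln_div algebra_simps)
qed (use assms in auto)

text \<open>Strict weighted AM-GM inequality, a consequence of the strict concavity of the
  logarithm.\<close>

lemma powr_mult_powr_less:
  fixes a b \<alpha> :: real
  assumes "0 < \<alpha>" "\<alpha> < 1" "0 \<le> a" "0 \<le> b" "a \<noteq> b"
  shows "a powr \<alpha> * b powr (1 - \<alpha>) < \<alpha> * a + (1 - \<alpha>) * b"
proof (cases "a = 0 \<or> b = 0")
  case True
  then show ?thesis
    using assms by auto
next
  case False
  then have pos: "0 < a" "0 < b"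
    using assms by auto
  \<comment> \<open>After division by the weighted mean, the bounds \<open>z - 1\<close> at
    \<open>z = a / m\<close> and \<open>z = b / m\<close> cancel in the weighted sum; the first
    tangent inequality is strict.\<close>
  define m where "m = \<alpha> * a + (1 - \<alpha>) * b"
  have m: "m > 0"
    unfolding m_def using pos assms by (intro add_pos_pos mult_pos_pos) auto
  have "(1 - \<alpha>) * (a - b) \<noteq> 0"
    using assms by simp
  then have "a / m \<noteq> 1"
    using m by (auto simp: m_def algebra_simps)
  then have "ln (a / m) < a / m - 1"
    using pos m ln_le_minus_one[of "a / m"] ln_eq_minus_one[of "a / m"] by fastforce
  then have 1: "\<alpha> * ln (a / m) < \<alpha> * (a / m - 1)"
    using assms by simp
  have "ln (b / m) \<le> b / m - 1"
    using pos m by (intro ln_le_minus_one) auto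
  then have 2: "(1 - \<alpha>) * ln (b / m) \<le> (1 - \<alpha>) * (b / m - 1)"
    using assms by (intro mult_left_mono) auto
  have "\<alpha> * (a / m - 1) + (1 - \<alpha>) * (b / m - 1) = (\<alpha> * a + (1 - \<alpha>) * b) / m - 1"
    by (simp add: add_divide_distrib diff_divide_distrib algebra_simps)
  then have "\<alpha> * ln (a / m) + (1 - \<alpha>) * ln (b / m) < 0"
    using 1 2 m by (simp add: m_def[symmetric])
  then have "\<alpha> * ln a + (1 - \<alpha>) * ln b < ln m"
    using pos m by (simp add: ln_div algebra_simps)
  then have "exp (\<alpha> * ln a + (1 - \<alpha>) * ln b) < exp (ln m)"
    by simp
  then show ?thesis
    using pos m by (simp add: powr_def exp_add m_def[symmetric])
qed

text \<open>Strict AM-GM with weight \<open>1 / \<alpha>\<close>, solved for one of its arguments.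
  Since \<open>0 powr (1 - \<alpha>) = 0\<close>, the case \<open>b = 0 < a\<close> has to be
  excluded.\<close>

lemma powr_mult_powr_greater:
  fixes a b \<alpha> :: real
  assumes "1 < \<alpha>" "0 \<le> a" "0 \<le> b" "b = 0 \<longrightarrow> a = 0" "a \<noteq> b"
  shows "\<alpha> * a + (1 - \<alpha>) * b < a powr \<alpha> * b powr (1 - \<alpha>)"
proof (cases "a = 0")
  case True
  then show ?thesis
    using assms by (auto simp: mult_less_0_iff)
next
  case False
  then have pos: "0 < a" "0 < b"
    using assms by auto
  \<comment> \<open>With this \<open>s\<close>, the number \<open>a\<close> is the weighted
    geometric mean of \<open>s\<close> and \<open>b\<close>, with weight \<open>1 / \<alpha>\<close>
    on \<open>s\<close>.\<close>
  define s where "s = a powr \<alpha> * b powr (1 - \<alpha>)"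
  have s: "s > 0"
    using pos by (simp add: s_def)
  have ln_s: "ln s = \<alpha> * ln a + (1 - \<alpha>) * ln b"
    using pos by (simp add: s_def ln_mult ln_powr)
  have "s \<noteq> b"
  proof
    assume "s = b"
    then have "\<alpha> * (ln a - ln b) = 0"
      using ln_s unfolding right_diff_distrib left_diff_distrib by simp
    then have "ln a = ln b"
      using assms by simp
    then show False
      using pos assms by simp
  qed
  then have "s powr (1 / \<alpha>) * b powr (1 - 1 / \<alpha>) < 1 / \<alpha> * s + (1 - 1 / \<alpha>) * b"
    using assms s pos by (intro powr_mult_powr_less) auto
  moreover have "s powr (1 / \<alpha>) * b powr (1 - 1 / \<alpha>) = a"
  proof -
    have "1 / \<alpha> * ln s + (1 - 1 / \<alpha>) * ln b = ln a"
      using assms by (simp add: ln_s field_simps)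
    then show ?thesis
      using s pos by (simp add: powr_def exp_add[symmetric])
  qed
  ultimately have "\<alpha> * a < \<alpha> * (1 / \<alpha> * s + (1 - 1 / \<alpha>) * b)"
    using assms by simp
  then show ?thesis
    using assms by (simp add: s_def[symmetric] algebra_simps)
qed

text \<open>Distinct distributions differ at some state, and there the termwise comparison is
  strict. \<open>F\<close> and \<open>G\<close> stay abstract so that one argument serves both
  divergences.\<close>

lemma sum_pmf_less:
  fixes p r :: "'x::finite pmf" and F G :: "real \<Rightarrow> real \<Rightarrow> real"
  assumes "p \<noteq> r"
    and "\<And>x. pmf p x \<noteq> pmf r x \<Longrightarrow> F (pmf p x) (pmf r x) < G (pmf p x) (pmf r x)"
    and "\<And>a. 0 \<le> a \<Longrightarrow> F a a = G a a"
  shows "(\<Sum>x\<in>UNIV. F (pmf p x) (pmf r x)) < (\<Sum>x\<in>UNIV. G (pmf p x) (pmf r x))"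
proof (rule sum_strict_mono_ex1)
  show "\<forall>x\<in>UNIV. F (pmf p x) (pmf r x) \<le> G (pmf p x) (pmf r x)"
  proof
    fix x
    show "F (pmf p x) (pmf r x) \<le> G (pmf p x) (pmf r x)"
      using assms(2)[of x] assms(3)[of "pmf p x"] by (cases "pmf p x = pmf r x") auto
  qed
  obtain x where "pmf p x \<noteq> pmf r x"
    using assms(1) by (metis pmf_eqI)
  then show "\<exists>x\<in>UNIV. F (pmf p x) (pmf r x) < G (pmf p x) (pmf r x)"
    using assms(2) by blast
qed simp

lemma KL_pos:
  assumes "set_pmf p \<subseteq> set_pmf r" and "p \<noteq> r"
  shows "KL p r > 0"
proof -
  \<comment> \<open>The left side is zero because both distributions have total mass one.\<close>
  have "(\<Sum>x\<in>UNIV. pmf p x - pmf r x) < (\<Sum>x\<in>UNIV. pmf p x * ln (pmf p x / pmf r x))"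
  proof (rule sum_pmf_less[where F = "\<lambda>a b. a - b" and G = "\<lambda>a b. a * ln (a / b)"])
    show "pmf p x - pmf r x < pmf p x * ln (pmf p x / pmf r x)" if "pmf p x \<noteq> pmf r x" for x
      using assms(1) that by (intro mult_ln_div_gt) (auto simp: set_pmf_iff)
  qed (use assms(2) in auto)
  then show ?thesis
    by (simp add: KL_def sum_subtractf sum_pmf_UNIV)
qed

lemma KL_self [simp]: "KL p p = 0"
  unfolding KL_def by (intro sum.neutral) auto

lemma powr_mult_powr_self: "0 \<le> a \<Longrightarrow> a powr \<alpha> * a powr (1 - \<alpha>) = (a :: real)"
  by (simp add: powr_add[symmetric])

text \<open>States outside the common support contribute nothing because \<open>0 powr a = 0\<close>
  for every exponent, negative ones included.\<close>

lemma renyi_eq_ln_sum_UNIV: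
  assumes "\<alpha> \<noteq> 1"
  shows "renyi \<alpha> p r =
    1 / (\<alpha> * (\<alpha> - 1)) * ln (\<Sum>x\<in>UNIV. pmf p x powr \<alpha> * pmf r x powr (1 - \<alpha>))"
proof -
  have "(\<Sum>x\<in>set_pmf p \<inter> set_pmf r. pmf p x powr \<alpha> * pmf r x powr (1 - \<alpha>)) =
      (\<Sum>x\<in>UNIV. pmf p x powr \<alpha> * pmf r x powr (1 - \<alpha>))"
    by (intro sum.mono_neutral_left) (auto simp: set_pmf_iff)
  then show ?thesis
    using assms by (simp add: renyi_def)
qed

lemma renyi_sum_pos:
  assumes "renyi_defined \<alpha> p r"
  shows "(\<Sum>x\<in>UNIV. pmf p x powr \<alpha> * pmf r x powr (1 - \<alpha>)) > 0"
proof -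
  obtain x where "x \<in> set_pmf p \<inter> set_pmf r"
    using assms set_pmf_not_empty[of p] by (auto simp: renyi_defined_def split: if_splits)
  then have "pmf p x powr \<alpha> * pmf r x powr (1 - \<alpha>) > 0"
    by (auto simp: set_pmf_iff)
  then show ?thesis
    by (intro sum_pos2[of _ x]) auto
qed

lemma renyi_self:
  assumes "\<alpha> > 0"
  shows "renyi \<alpha> p p = 0"
proof (cases "\<alpha> = 1")
  case False
  then show ?thesis
    by (simp add: renyi_eq_ln_sum_UNIV powr_mult_powr_self sum_pmf_UNIV)
qed (simp add: renyi_def)

text \<open>The power sum is compared with an affine sum equal to one. It is smaller for \<alpha> <
  1 and larger for \<alpha> > 1, and the prefactor changes sign accordingly; at \<alpha> = 1 this is
  Gibbs' inequality.\<close>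

lemma renyi_pos:
  assumes "\<alpha> > 0" and "renyi_defined \<alpha> p r" and "p \<noteq> r"
  shows "renyi \<alpha> p r > 0"
proof -
  let ?S = "\<Sum>x\<in>UNIV. pmf p x powr \<alpha> * pmf r x powr (1 - \<alpha>)"
  have affine: "(\<Sum>x\<in>UNIV. \<alpha> * pmf p x + (1 - \<alpha>) * pmf r x) = 1"
    by (simp add: sum.distrib sum_distrib_left[symmetric] sum_pmf_UNIV)
  consider "\<alpha> < 1" | "\<alpha> = 1" | "\<alpha> > 1"
    by linarith
  then show ?thesis
  proof cases
    case 1
    have "?S < (\<Sum>x\<in>UNIV. \<alpha> * pmf p x + (1 - \<alpha>) * pmf r x)"
      using assms 1
      by (intro sum_pmf_less[where F = "\<lambda>a b. a powr \<alpha> * b powr (1 - \<alpha>)"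
            and G = "\<lambda>a b. \<alpha> * a + (1 - \<alpha>) * b"] powr_mult_powr_less)
        (auto simp: powr_mult_powr_self algebra_simps)
    then have "ln ?S < 0"
      using affine renyi_sum_pos[OF assms(2)] by simp
    moreover have "\<alpha> * (\<alpha> - 1) < 0"
      using assms 1 by (simp add: mult_less_0_iff)
    ultimately show ?thesis
      using 1 by (simp add: renyi_eq_ln_sum_UNIV zero_less_divide_iff)
  next
    case 2
    then show ?thesis
      using assms by (simp add: renyi_def renyi_defined_def KL_pos)
  next
    case 3
    have "(\<Sum>x\<in>UNIV. \<alpha> * pmf p x + (1 - \<alpha>) * pmf r x) < ?S"
      using assms 3
      by (intro sum_pmf_less[where G = "\<lambda>a b. a powr \<alpha> * b powr (1 - \<alpha>)"
            and F = "\<lambda>a b. \<alpha> * a + (1 - \<alpha>) * b"] powr_mult_powr_greater)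
        (auto simp: powr_mult_powr_self algebra_simps renyi_defined_def set_pmf_iff)
    then have "ln ?S > 0"
      using affine by simp
    then show ?thesis
      using 3 by (simp add: renyi_eq_ln_sum_UNIV)
  qed
qed

section \<open>Divergences of tilted distributions\<close>

text \<open>Tilting adds \<open>f x - ln (partition_sum r f)\<close> to the log-density of
  \<open>r\<close>; averaging over \<open>p\<close> gives the correction. With nonnegativity of the
  left side this is Gibbs' variational principle.\<close>

lemma KL_tilt:
  assumes "set_pmf p \<subseteq> set_pmf r"
  shows "KL p (tilt r f) = KL p r - measure_pmf.expectation p f + ln (partition_sum r f)"
proof -
  have "pmf p x * ln (pmf p x / pmf (tilt r f) x) =
      pmf p x * ln (pmf p x / pmf r x) - pmf p x * f x + pmf p x * ln (partition_sum r f)" for x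
  proof (cases "pmf p x = 0")
    case False
    then have "0 < pmf p x" "0 < pmf r x"
      using assms by (auto simp: set_pmf_iff pmf_positive_iff)
    then show ?thesis
      using partition_sum_pos[of r f] by (simp add: pmf_tilt ln_div ln_mult algebra_simps)
  qed simp
  then show ?thesis
    by (simp add: KL_def expectation_pmf_finite sum.distrib sum_subtractf
        sum_distrib_right[symmetric] sum_pmf_UNIV)
qed

text \<open>The last summand does not involve \<open>u\<close>, so minimizing the left side means
  minimizing a divergence. Its value at \<alpha> = 1 is the limit of the other branch.\<close>

lemma renyi_plus_Psi:
  assumes "\<alpha> > 0" and "renyi_defined \<alpha> p u"
  shows "renyi \<alpha> p u + Psi \<alpha> u f =
    renyi \<alpha> (tilt p (\<lambda>x. (\<alpha> - 1) * f x)) (tilt u (\<lambda>x. \<alpha> * f x)) +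
    (if \<alpha> = 1 then measure_pmf.expectation p f
     else 1 / (\<alpha> - 1) * ln (partition_sum p (\<lambda>x. (\<alpha> - 1) * f x)))"
proof (cases "\<alpha> = 1")
  case True
  \<comment> \<open>Here the first argument is tilted by zero, hence unchanged, and
    \<open>KL_tilt\<close> accounts for the second.\<close>
  then show ?thesis
    using assms KL_tilt[of p u f]
    by (simp add: renyi_def renyi_defined_def Psi_eq_ln_partition_sum tilt_zero)
next
  case False
  let ?P = "tilt p (\<lambda>x. (\<alpha> - 1) * f x)" and ?R = "tilt u (\<lambda>x. \<alpha> * f x)"
  let ?S = "\<Sum>x\<in>UNIV. pmf p x powr \<alpha> * pmf u x powr (1 - \<alpha>)"
  define Z where "Z = partition_sum p (\<lambda>x. (\<alpha> - 1) * f x)"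
  define C where "C = partition_sum u (\<lambda>x. \<alpha> * f x)"
  have pos: "Z > 0" "C > 0"
    by (simp_all add: Z_def C_def partition_sum_pos)
  have "pmf ?P x powr \<alpha> * pmf ?R x powr (1 - \<alpha>) =
      Z powr (- \<alpha>) * C powr (\<alpha> - 1) * (pmf p x powr \<alpha> * pmf u x powr (1 - \<alpha>))" for x
  proof -
    \<comment> \<open>The two tilting exponents are matched so that \<alpha> (\<alpha> - 1) + (1 -
      \<alpha>) \<alpha> = 0; only the normalizers survive.\<close>
    have "exp ((\<alpha> - 1) * f x) powr \<alpha> * exp (\<alpha> * f x) powr (1 - \<alpha>) = 1"
      by (simp add: powr_def exp_add[symmetric] algebra_simps)
    moreover have "pmf ?P x powr \<alpha> =
        pmf p x powr \<alpha> * exp ((\<alpha> - 1) * f x) powr \<alpha> * Z powr (- \<alpha>)"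
      using pos by (simp add: pmf_tilt Z_def[symmetric] powr_divide powr_mult powr_minus_divide)
    moreover have "pmf ?R x powr (1 - \<alpha>) =
        pmf u x powr (1 - \<alpha>) * exp (\<alpha> * f x) powr (1 - \<alpha>) * C powr (\<alpha> - 1)"
      using pos powr_minus_divide[of C "1 - \<alpha>"]
      by (simp add: pmf_tilt C_def[symmetric] powr_divide powr_mult)
    ultimately show ?thesis
      by simp
  qed
  then have "(\<Sum>x\<in>UNIV. pmf ?P x powr \<alpha> * pmf ?R x powr (1 - \<alpha>)) =
      Z powr (- \<alpha>) * C powr (\<alpha> - 1) * ?S"
    by (simp add: sum_distrib_left)
  then have "renyi \<alpha> ?P ?R =
      1 / (\<alpha> * (\<alpha> - 1)) * ln (Z powr (- \<alpha>) * C powr (\<alpha> - 1) * ?S)"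
    using False by (simp add: renyi_eq_ln_sum_UNIV)
  also have "\<dots> = 1 / (\<alpha> * (\<alpha> - 1)) * (- \<alpha> * ln Z + (\<alpha> - 1) * ln C + ln ?S)"
    using pos renyi_sum_pos[OF assms(2)] by (simp add: ln_mult ln_powr)
  also have "\<dots> = - (1 / (\<alpha> - 1) * ln Z) + 1 / \<alpha> * ln C + renyi \<alpha> p u"
  proof -
    have "1 / (\<alpha> * (\<alpha> - 1)) * (- \<alpha> * a + (\<alpha> - 1) * b + c) =
        - (1 / (\<alpha> - 1) * a) + 1 / \<alpha> * b + 1 / (\<alpha> * (\<alpha> - 1)) * c" for a b c
    proof -
      have "\<alpha> - 1 \<noteq> 0" "\<alpha> \<noteq> 0"
        using False assms by auto
      then show ?thesis
        by (simp add: divide_simps)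
    qed
    then show ?thesis
      unfolding renyi_eq_ln_sum_UNIV[OF False] .
  qed
  finally show ?thesis
    using False by (simp add: Psi_eq_ln_partition_sum Z_def C_def)
qed

section \<open>One stage of the game\<close>

text \<open>\<open>KL_tilt\<close> merges the \<open>KL\<close> cost and the expected next value
  into \<open>Psi\<close> minus a divergence from the tilted control. Only that divergence depends
  on \<open>ua\<close>.\<close>

lemma game_objective_eq:
  assumes "\<alpha> > 0" and "set_pmf ua \<subseteq> set_pmf uc"
  shows "game_objective \<alpha> \<pi>0 q v t x uc ua =
    q x t + rlc_objective \<alpha> \<pi>0 v t x uc - 1 / \<alpha> * KL ua (tilt uc (\<lambda>y. \<alpha> * v (Suc t) y))"
proof -
  have "measure_pmf.expectation ua (\<lambda>y. \<alpha> * v (Suc t) y) =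
      \<alpha> * measure_pmf.expectation ua (v (Suc t))"
    by simp
  then show ?thesis
    using assms(1) unfolding KL_tilt[OF assms(2)]
    by (simp add: game_objective_def stage_cost_def rlc_objective_def Psi_eq_ln_partition_sum
        field_simps)
qed

lemma tilt_in_adversary_controls: "tilt uc f \<in> adversary_controls uc"
  by (simp add: adversary_controls_def)

lemma game_objective_less:
  assumes "\<alpha> > 0" and "ua \<in> adversary_controls uc" and "ua \<noteq> tilt uc (\<lambda>y. \<alpha> * v (Suc t) y)"
  shows "game_objective \<alpha> \<pi>0 q v t x uc ua <
    game_objective \<alpha> \<pi>0 q v t x uc (tilt uc (\<lambda>y. \<alpha> * v (Suc t) y))"
  using assms KL_pos[of ua "tilt uc (\<lambda>y. \<alpha> * v (Suc t) y)"]
  by (simp add: game_objective_eq adversary_controls_def)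

lemma is_arg_max_game_objective_iff:
  assumes "\<alpha> > 0"
  shows "is_arg_max (game_objective \<alpha> \<pi>0 q v t x uc) (\<lambda>u. u \<in> adversary_controls uc) ua \<longleftrightarrow>
    ua = tilt uc (\<lambda>y. \<alpha> * v (Suc t) y)"
  by (intro is_arg_max_iff_unique tilt_in_adversary_controls game_objective_less assms)

text \<open>At the best response the divergence in \<open>game_objective_eq\<close> vanishes, which
  leaves the risk-sensitive objective.\<close>

lemma worst_case_eq:
  assumes "\<alpha> > 0"
  shows "worst_case \<alpha> \<pi>0 q v t x uc = q x t + rlc_objective \<alpha> \<pi>0 v t x uc"
proof -
  have "worst_case \<alpha> \<pi>0 q v t x uc =
      game_objective \<alpha> \<pi>0 q v t x uc (tilt uc (\<lambda>y. \<alpha> * v (Suc t) y))"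
    unfolding worst_case_def
  proof (intro max_over_eqI tilt_in_adversary_controls)
    show "game_objective \<alpha> \<pi>0 q v t x uc ua \<le>
        game_objective \<alpha> \<pi>0 q v t x uc (tilt uc (\<lambda>y. \<alpha> * v (Suc t) y))"
      if "ua \<in> adversary_controls uc" for ua
      using game_objective_less[OF assms that, where v = v and t = t] by (metis order.refl less_imp_le)
  qed
  then show ?thesis
    using assms by (simp add: game_objective_eq)
qed

text \<open>Tilting preserves the support, so the divergence is defined in both regimes of
  \<alpha>.\<close>

lemma tilt_in_controls: "tilt (\<pi>0 x) f \<in> controls \<alpha> \<pi>0 x"
  by (simp add: controls_def renyi_defined_def set_pmf_not_empty)

lemma rlc_objective_less:
  assumes "\<alpha> > 0" and "u \<in> controls \<alpha> \<pi>0 x" and "u \<noteq> tilt (\<pi>0 x) (\<lambda>y. - v (Suc t) y)"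
  shows "rlc_objective \<alpha> \<pi>0 v t x (tilt (\<pi>0 x) (\<lambda>y. - v (Suc t) y)) < rlc_objective \<alpha> \<pi>0 v t x u"
proof -
  let ?f = "v (Suc t)"
  let ?u = "tilt (\<pi>0 x) (\<lambda>y. - ?f y)" and ?P = "tilt (\<pi>0 x) (\<lambda>y. (\<alpha> - 1) * ?f y)"
  \<comment> \<open>The exponents add up to \<open>- f + \<alpha> f = (\<alpha> - 1) f\<close>, so
    at the candidate both arguments of the tilted divergence agree.\<close>
  have opt: "tilt ?u (\<lambda>y. \<alpha> * ?f y) = ?P"
    by (simp add: tilt_tilt algebra_simps)
  have "tilt u (\<lambda>y. \<alpha> * ?f y) \<noteq> ?P"
    unfolding opt[symmetric] using assms(3) by simp
  moreover have "renyi_defined \<alpha> ?P (tilt u (\<lambda>y. \<alpha> * ?f y))"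
    using assms(2) by (simp add: controls_def renyi_defined_def)
  ultimately have "renyi \<alpha> ?P (tilt u (\<lambda>y. \<alpha> * ?f y)) > 0"
    using assms(1) by (intro renyi_pos) auto
  then show ?thesis
    using assms(2) tilt_in_controls[of \<pi>0 x "\<lambda>y. - ?f y" \<alpha>] assms(1)
    by (simp add: rlc_objective_def controls_def renyi_plus_Psi opt renyi_self)
qed

lemma is_arg_min_rlc_objective_iff:
  assumes "\<alpha> > 0"
  shows "is_arg_min (rlc_objective \<alpha> \<pi>0 v t x) (\<lambda>u. u \<in> controls \<alpha> \<pi>0 x) uc \<longleftrightarrow>
    uc = tilt (\<pi>0 x) (\<lambda>y. - v (Suc t) y)"
  by (intro is_arg_min_iff_unique tilt_in_controls rlc_objective_less assms)

lemma is_arg_min_worst_case_iff: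
  assumes "\<alpha> > 0"
  shows "is_arg_min (worst_case \<alpha> \<pi>0 q v t x) (\<lambda>u. u \<in> controls \<alpha> \<pi>0 x) uc \<longleftrightarrow>
    uc = tilt (\<pi>0 x) (\<lambda>y. - v (Suc t) y)"
  using assms
  by (intro is_arg_min_iff_unique tilt_in_controls) (simp add: worst_case_eq rlc_objective_less)

text \<open>Both minima are attained at the same control, so the two \<open>LEAST\<close> values are
  genuine and differ by the state cost.\<close>

lemma min_over_worst_case_eq:
  assumes "\<alpha> > 0"
  shows "min_over (worst_case \<alpha> \<pi>0 q v t x) (controls \<alpha> \<pi>0 x) =
    q x t + min_over (rlc_objective \<alpha> \<pi>0 v t x) (controls \<alpha> \<pi>0 x)"
proof -
  let ?u = "tilt (\<pi>0 x) (\<lambda>y. - v (Suc t) y)"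
  have le: "rlc_objective \<alpha> \<pi>0 v t x ?u \<le> rlc_objective \<alpha> \<pi>0 v t x u"
    if "u \<in> controls \<alpha> \<pi>0 x" for u
    using rlc_objective_less[OF assms that] by (metis order.refl less_imp_le)
  have "min_over (worst_case \<alpha> \<pi>0 q v t x) (controls \<alpha> \<pi>0 x) = worst_case \<alpha> \<pi>0 q v t x ?u"
    using assms le by (intro min_over_eqI tilt_in_controls) (simp add: worst_case_eq)
  moreover have "min_over (rlc_objective \<alpha> \<pi>0 v t x) (controls \<alpha> \<pi>0 x) =
      rlc_objective \<alpha> \<pi>0 v t x ?u"
    using le by (intro min_over_eqI tilt_in_controls)
  ultimately show ?thesis
    using assms by (simp add: worst_case_eq)
qed

section \<open>The dynamic programs\<close>

lemma bellman_isaacs_iff_rlc_bellman: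
  assumes "\<alpha> > 0"
  shows "bellman_isaacs \<alpha> \<pi>0 q T v \<longleftrightarrow> rlc_bellman \<alpha> \<pi>0 q T v"
  using assms by (simp add: bellman_isaacs_def rlc_bellman_def min_over_worst_case_eq)

lemma rlc_objective_cong:
  "v (Suc t) = w (Suc t) \<Longrightarrow> rlc_objective \<alpha> \<pi>0 v t x = rlc_objective \<alpha> \<pi>0 w t x"
  by (rule ext) (simp add: rlc_objective_def)

text \<open>Backward induction from the horizon, where the value is prescribed; nothing is claimed
  for later times.\<close>

lemma rlc_bellman_unique:
  assumes "rlc_bellman \<alpha> \<pi>0 q T v" and "rlc_bellman \<alpha> \<pi>0 q T w" and "t \<le> T"
  shows "v t = w t"
  using assms(3)
proof (induction t rule: inc_induct)
  case base
  then show ?case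
    using assms(1,2) by (auto simp: rlc_bellman_def)
next
  case (step t)
  then show ?case
    using assms(1,2) rlc_objective_cong[of v t w, OF step.IH] by (auto simp: rlc_bellman_def)
qed

text \<open>The value function \<open>w\<close> hidden in \<open>rlc_optimal\<close> agrees with
  \<open>v\<close> up to time \<open>T\<close>, and the minimizer at \<open>t < T\<close> only sees
  time \<open>Suc t \<le> T\<close>.\<close>

lemma rlc_optimal_iff:
  assumes "\<alpha> > 0" and "rlc_bellman \<alpha> \<pi>0 q T v"
  shows "rlc_optimal \<alpha> \<pi>0 q T \<pi> \<longleftrightarrow>
    (\<forall>t<T. \<pi> t = (\<lambda>x. tilt (\<pi>0 x) (\<lambda>y. - v (Suc t) y)))"
proof -
  have "w (Suc t) = v (Suc t)" if "rlc_bellman \<alpha> \<pi>0 q T w" "t < T" for w t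
    using rlc_bellman_unique[OF that(1) assms(2)] that(2) by simp
  then have "(\<forall>t<T. \<forall>x. \<pi> t x = tilt (\<pi>0 x) (\<lambda>y. - w (Suc t) y)) \<longleftrightarrow>
      (\<forall>t<T. \<forall>x. \<pi> t x = tilt (\<pi>0 x) (\<lambda>y. - v (Suc t) y))"
    if "rlc_bellman \<alpha> \<pi>0 q T w" for w
    using that by simp
  then show ?thesis
    unfolding rlc_optimal_def is_arg_min_rlc_objective_iff[OF assms(1)] fun_eq_iff
    using assms(2) by blast
qed

text \<open>The first conjunct ensures that the \<open>GREATEST\<close> in \<open>max_over\<close>
  is attained. The equivalences, instantiated at \<open>\<pi>co\<close> and \<open>\<pi>a\<close>,
  give existence as well as uniqueness of the optimal strategies before the horizon.\<close>

theorem mainTheorem3: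
  fixes \<alpha> :: real and \<pi>0 :: "'x::finite \<Rightarrow> 'x pmf" and q :: "'x \<Rightarrow> nat \<Rightarrow> real"
    and T :: nat and v :: "nat \<Rightarrow> 'x \<Rightarrow> real"
  assumes "\<alpha> > 0" and "T \<ge> 1" and "bellman_isaacs \<alpha> \<pi>0 q T v"
  shows "(\<forall>t<T. \<forall>x. \<forall>uc\<in>controls \<alpha> \<pi>0 x.
            \<exists>ua. is_arg_max (game_objective \<alpha> \<pi>0 q v t x uc) (\<lambda>u. u \<in> adversary_controls uc) ua) \<and>
         rlc_bellman \<alpha> \<pi>0 q T v \<and>
         (\<exists>\<pi>co \<pi>a.
            (\<forall>\<pi>. controller_optimal \<alpha> \<pi>0 q T v \<pi> \<longleftrightarrow> (\<forall>t<T. \<pi> t = \<pi>co t)) \<and>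
            (\<forall>\<pi>. rlc_optimal \<alpha> \<pi>0 q T \<pi> \<longleftrightarrow> (\<forall>t<T. \<pi> t = \<pi>co t)) \<and>
            (\<forall>\<rho>. adversary_best_response \<alpha> \<pi>0 q T v \<pi>co \<rho> \<longleftrightarrow> (\<forall>t<T. \<rho> t = \<pi>a t)) \<and>
            (\<forall>t<T. \<forall>x.
               proportional (pmf (\<pi>a t x)) (\<lambda>x'. pmf (\<pi>co t x) x' * exp (\<alpha> * v (Suc t) x')) \<and>
               proportional (\<lambda>x'. pmf (\<pi>co t x) x' * exp (\<alpha> * v (Suc t) x'))
                 (\<lambda>x'. pmf (\<pi>0 x) x' * exp ((\<alpha> - 1) * v (Suc t) x'))))"
proof -
  define \<pi>co where "\<pi>co = (\<lambda>t x. tilt (\<pi>0 x) (\<lambda>y. - v (Suc t) y))"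
  define \<pi>a where "\<pi>a = (\<lambda>t x. tilt (\<pi>co t x) (\<lambda>y. \<alpha> * v (Suc t) y))"
  have rlc: "rlc_bellman \<alpha> \<pi>0 q T v"
    using assms bellman_isaacs_iff_rlc_bellman by blast
  have co: "controller_optimal \<alpha> \<pi>0 q T v \<pi> \<longleftrightarrow> (\<forall>t<T. \<pi> t = \<pi>co t)" for \<pi>
    using assms(1) by (simp add: controller_optimal_def is_arg_min_worst_case_iff \<pi>co_def fun_eq_iff)
  have opt: "rlc_optimal \<alpha> \<pi>0 q T \<pi> \<longleftrightarrow> (\<forall>t<T. \<pi> t = \<pi>co t)" for \<pi>
    using rlc_optimal_iff[OF assms(1) rlc] by (simp add: \<pi>co_def)
  have adv: "adversary_best_response \<alpha> \<pi>0 q T v \<pi>co \<rho> \<longleftrightarrow> (\<forall>t<T. \<rho> t = \<pi>a t)" for \<rho>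
    using assms(1)
    by (simp add: adversary_best_response_def is_arg_max_game_objective_iff \<pi>a_def fun_eq_iff)
  have prop1: "proportional (pmf (\<pi>a t x)) (\<lambda>y. pmf (\<pi>co t x) y * exp (\<alpha> * v (Suc t) y))" for t x
    unfolding \<pi>a_def by (rule proportional_tilt)
  have prop2: "proportional (\<lambda>y. pmf (\<pi>co t x) y * exp (\<alpha> * v (Suc t) y))
      (\<lambda>y. pmf (\<pi>0 x) y * exp ((\<alpha> - 1) * v (Suc t) y))" for t x
    unfolding proportional_def
  proof (intro exI conjI allI)
    \<comment> \<open>The constant is the normalization of \<open>\<pi>co t x\<close>, the only
      factor left once the exponents are combined.\<close>
    show "1 / partition_sum (\<pi>0 x) (\<lambda>y. - v (Suc t) y) > 0"
      by (simp add: partition_sum_pos)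
    show "pmf (\<pi>co t x) y * exp (\<alpha> * v (Suc t) y) =
        1 / partition_sum (\<pi>0 x) (\<lambda>y. - v (Suc t) y) *
          (pmf (\<pi>0 x) y * exp ((\<alpha> - 1) * v (Suc t) y))" for y
      by (simp add: \<pi>co_def pmf_tilt left_diff_distrib exp_diff exp_minus field_simps)
  qed
  show ?thesis
    using is_arg_max_game_objective_iff[OF assms(1)] rlc co opt adv prop1 prop2 by blast
qed

end
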